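(* Let $V$ be a finite set, let $\mathcal{M}=(V,\mathcal{F})$ be a matroid whose maximum independent sets have cardinality $K\ge 1$, and let $f:2^V\to\mathbb{R}$ be strictly increasing with submodularity ratio $\gamma$. Let $S^*$ be an optimal solution of the problem of maximizing $f(S)$ over $S\in\mathcal{F}$, and let $S^{\mathsf f}$ be the set returned by the forward greedy algorithm over the matroid. Then $$\frac{f(S^{\mathsf f})-f(\emptyset)}{f(S^* )-f(\emptyset)}\ \ge\ \frac{\gamma^3}{\gamma^3+1}.$$
   Context: For $f:2^V\to\mathbb{R}$, $S\subset V$ and $v\in V$, write $\rho_v(S)=f(S\cup\{v\})-f(S)$. The function $f$ is strictly increasing if $f(S_1)<f(S_2)$ whenever $S_1\subsetneq S_2\subset V$. The submodularity ratio of an increasing $f$ is the largest $\gamma\ge 0$ such that $\gamma\,\rho_v(S\cup U)\le \rho_v(S)$ for all $S,U\subset V$ and all $v\in V\setminus(S\cup U)$ (here $\subset$ allows equality); one has $\gamma\in[0,1]$. A matroid $(V,\mathcal F)$ is given by its collection $\mathcal F$ of independent sets; maximum independent sets are those of largest cardinality. Forward greedy algorithm over the matroid: start with $S=\emptyset$, $U=\emptyset$. While $U\ne V$ and $|S|<K$: choose $i\in V\setminus U$ maximizing $\rho_i(S)$ (ties broken arbitrarily); if $S\cup\{i\}\notin\mathcal F$, replace $U$ by $U\cup\{i\}$ and leave $S$ unchanged; otherwise replace both $S$ by $S\cup\{i\}$ and $U$ by $U\cup\{i\}$. Return $S^{\mathsf f}=S$. *)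

theory Defs
  imports Complex_Main
begin

locale matroid =
  fixes V :: "'a set" and F :: "'a set set"
  assumes finite_ground: "finite V"
    and indep_subset_ground: "\<And>A. A \<in> F \<Longrightarrow> A \<subseteq> V"
    and indep_empty: "{} \<in> F"
    and indep_subset: "\<And>A B. A \<in> F \<Longrightarrow> B \<subseteq> A \<Longrightarrow> B \<in> F"
    and indep_augment:
      "\<And>A B. A \<in> F \<Longrightarrow> B \<in> F \<Longrightarrow> card A < card B \<Longrightarrow> \<exists>x \<in> B - A. A \<union> {x} \<in> F"

definition matroid_rank :: "'a set set \<Rightarrow> nat" where
  "matroid_rank F = Max (card ` F)"

definition gain :: "('a set \<Rightarrow> real) \<Rightarrow> 'a \<Rightarrow> 'a set \<Rightarrow> real" where
  "gain f v S = f (S \<union> {v}) - f S"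

definition submodularity_bound :: "'a set \<Rightarrow> ('a set \<Rightarrow> real) \<Rightarrow> real \<Rightarrow> bool" where
  "submodularity_bound V f \<gamma> \<longleftrightarrow>
     \<gamma> \<ge> 0 \<and>
     (\<forall>S U. S \<subseteq> V \<longrightarrow> U \<subseteq> V \<longrightarrow> (\<forall>v \<in> V - (S \<union> U). \<gamma> * gain f v (S \<union> U) \<le> gain f v S))"

definition submodularity_ratio :: "'a set \<Rightarrow> ('a set \<Rightarrow> real) \<Rightarrow> real" where
  "submodularity_ratio V f = (GREATEST \<gamma>. submodularity_bound V f \<gamma>)"

text \<open>For nonempty \<open>V\<close> and strictly increasing \<open>f\<close> the greatest such \<open>\<gamma>\<close> exists
  (for empty \<open>V\<close> every nonnegative \<open>\<gamma>\<close> is a bound).\<close>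

lemma submodularity_ratio_properties:
  fixes V :: "'a set" and f :: "'a set \<Rightarrow> real"
  assumes ne: "V \<noteq> {}" and mono: "strict_mono_on (Pow V) f"
  shows submodularity_bound_ratio: "submodularity_bound V f (submodularity_ratio V f)"
    and submodularity_ratio_greatest:
      "submodularity_bound V f \<gamma> \<Longrightarrow> \<gamma> \<le> submodularity_ratio V f"
    and submodularity_ratio_le_1: "submodularity_ratio V f \<le> 1"
proof -
  let ?B = "submodularity_bound V f"
  have pos: "gain f v S > 0" if "S \<subseteq> V" "v \<in> V - S" for v S
  proof -
    have "S \<subset> S \<union> {v}" "S \<union> {v} \<subseteq> V" using that by auto
    then have "f S < f (S \<union> {v})"
      using mono that(1) by (auto simp: monotone_on_def)
    then show ?thesis by (simp add: gain_def)
  qed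
  have le1: "\<gamma> \<le> 1" if "?B \<gamma>" for \<gamma>
  proof -
    obtain v where v: "v \<in> V" using ne by blast
    have "\<gamma> * gain f v ({} \<union> {}) \<le> gain f v {}"
      using that v unfolding submodularity_bound_def by blast
    then show ?thesis using pos[of "{}" v] v by simp
  qed
  have "?B 0"
    unfolding submodularity_bound_def by (auto intro!: less_imp_le pos)
  have bdd: "bdd_above (Collect ?B)" using le1 by (intro bdd_aboveI[where M = 1]) simp
  define g where "g = Sup (Collect ?B)"
  have upper: "\<gamma> \<le> g" if "?B \<gamma>" for \<gamma>
    unfolding g_def using that bdd by (auto intro: cSup_upper)
  have "?B g"
    unfolding submodularity_bound_def
  proof (intro conjI allI impI ballI)
    show "g \<ge> 0" using upper \<open>?B 0\<close> by blast
    fix S U v assume SU: "S \<subseteq> V" "U \<subseteq> V" and v: "v \<in> V - (S \<union> U)"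
    have p: "gain f v (S \<union> U) > 0" using SU v by (intro pos) auto
    have "g \<le> gain f v S / gain f v (S \<union> U)"
      unfolding g_def
    proof (rule cSup_least)
      show "Collect ?B \<noteq> {}" using \<open>?B 0\<close> by blast
      fix x assume "x \<in> Collect ?B"
      then have "x * gain f v (S \<union> U) \<le> gain f v S"
        using SU v unfolding submodularity_bound_def by blast
      then show "x \<le> gain f v S / gain f v (S \<union> U)" using p by (simp add: pos_le_divide_eq)
    qed
    then show "g * gain f v (S \<union> U) \<le> gain f v S" using p by (simp add: pos_le_divide_eq)
  qed
  moreover from this have "submodularity_ratio V f = g"
    unfolding submodularity_ratio_def using upper by (rule Greatest_equality)
  ultimately show "?B (submodularity_ratio V f)"
    and "?B \<gamma> \<Longrightarrow> \<gamma> \<le> submodularity_ratio V f"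
    and "submodularity_ratio V f \<le> 1"
    using upper le1 by auto
qed

text \<open>One iteration of the loop body, on states \<open>(S, U)\<close>; nondeterminism models
  arbitrary tie-breaking.\<close>

inductive greedy_step ::
  "'a set \<Rightarrow> 'a set set \<Rightarrow> nat \<Rightarrow> ('a set \<Rightarrow> real) \<Rightarrow>
   'a set \<times> 'a set \<Rightarrow> 'a set \<times> 'a set \<Rightarrow> bool"
  for V F K f where
  reject: "\<lbrakk>U \<noteq> V; card S < K; is_arg_max (\<lambda>j. gain f j S) (\<lambda>j. j \<in> V - U) i;
            S \<union> {i} \<notin> F\<rbrakk>
    \<Longrightarrow> greedy_step V F K f (S, U) (S, U \<union> {i})"
| accept: "\<lbrakk>U \<noteq> V; card S < K; is_arg_max (\<lambda>j. gain f j S) (\<lambda>j. j \<in> V - U) i;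
            S \<union> {i} \<in> F\<rbrakk>
    \<Longrightarrow> greedy_step V F K f (S, U) (S \<union> {i}, U \<union> {i})"

definition greedy_returns ::
  "'a set \<Rightarrow> 'a set set \<Rightarrow> nat \<Rightarrow> ('a set \<Rightarrow> real) \<Rightarrow> 'a set \<Rightarrow> bool" where
  "greedy_returns V F K f S \<longleftrightarrow>
     (\<exists>U. (greedy_step V F K f)\<^sup>*\<^sup>* ({}, {}) (S, U) \<and> \<not> (U \<noteq> V \<and> card S < K))"

end

theory Submission
  imports Defs
begin

text \<open>
  Write \<open>S\<close> for the greedy set and \<open>T\<close> for any independent set. Adding the elements of \<open>T - S\<close>
  to \<open>S\<close> one at a time turns \<open>f (S \<union> T) - f S\<close> into a telescoping sum of gains, and by the
  submodularity ratio \<open>\<gamma>\<close> times each of these gains, the \<^emph>\<open>charge\<close> \<open>c x\<close> of the element \<open>x\<close>, is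
  at most the gain of \<open>x\<close> over every subset of \<open>S\<close>, in particular over every intermediate
  greedy set (lemma \<open>charges_exist\<close>).

  The charges of the whole of \<open>T\<close> add up to at most \<open>f S - f {}\<close>. Indeed, as long as \<open>x\<close> has not
  been examined it competes with every accepted element, so \<open>c x\<close> is at most the gain realised
  by each acceptance that occurs before \<open>x\<close> is examined. The examined elements lie in the span of
  the accepted ones, so at every moment at most as many elements of \<open>T\<close> have been examined as
  elements have been accepted: the elements of \<open>T\<close> can be matched with distinct acceptances
  that pay for them (lemmas \<open>greedy_pays_examined\<close> and \<open>greedy_pays\<close>).

  Hence \<open>\<gamma> * (f T - f S) \<le> \<gamma> * (f (S \<union> T) - f S) \<le> f S - f {}\<close>, which bounds the ratio
  from below by \<open>\<gamma> / (\<gamma> + 1)\<close>. Since \<open>0 \<le> \<gamma> \<le> 1\<close>, this is at least \<open>\<gamma>\<^sup>3 / (\<gamma>\<^sup>3 + 1)\<close>.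
\<close>

section \<open>Elementary facts\<close>

lemma gain_nonneg:
  assumes "strict_mono_on (Pow V) f" "S \<subseteq> V" "x \<in> V"
  shows "0 \<le> gain f x S"
proof -
  have "f S \<le> f (S \<union> {x})"
    using assms by (intro strict_mono_on_leD[OF assms(1)]) auto
  then show ?thesis by (simp add: gain_def)
qed

text \<open>The assumption on \<open>U\<close> says that \<open>U\<close> lies in the span of \<open>S\<close>.\<close>

lemma (in matroid) card_le_of_subset_span:
  assumes "S \<in> F" "\<forall>x \<in> U - S. S \<union> {x} \<notin> F" "T \<in> F" "T \<subseteq> U"
  shows "card T \<le> card S"
  using indep_augment[of S T] assms by (meson DiffD1 DiffD2 DiffI not_le subsetD)

lemma (in matroid) finite_indep: "finite F"
  using finite_ground indep_subset_ground by (meson PowI finite_Pow_iff finite_subset subsetI)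

lemma (in matroid) card_le_matroid_rank:
  assumes "T \<in> F"
  shows "card T \<le> matroid_rank F"
  using assms finite_indep by (simp add: matroid_rank_def)

section \<open>Charges from the submodularity ratio\<close>

text \<open>Each charge is \<open>\<gamma>\<close> times the gain of its element at the moment when it is added to the set
  built so far, which starts from \<open>S\<close> and contains every \<open>R \<subseteq> S\<close>; the submodularity ratio
  compares this gain with the one over \<open>R\<close>. Outside \<open>D\<close> the charge is zero.\<close>

lemma charges_exist:
  assumes bound: "submodularity_bound V f \<gamma>" and mono: "strict_mono_on (Pow V) f"
    and "S \<subseteq> V" and "finite D" "D \<subseteq> V - S"
  shows "\<exists>c. (\<forall>x. 0 \<le> c x) \<and> (\<forall>x. x \<notin> D \<longrightarrow> c x = 0) \<and>
             (\<forall>R x. R \<subseteq> S \<longrightarrow> x \<in> V \<longrightarrow> c x \<le> gain f x R \<or> x \<in> R) \<and>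
             sum c D = \<gamma> * (f (S \<union> D) - f S)"
  using assms(4,5)
proof (induction D rule: finite_induct)
  case empty
  have "0 \<le> gain f x R" if "R \<subseteq> S" "x \<in> V" for R x
    using gain_nonneg[OF mono] that \<open>S \<subseteq> V\<close> by auto
  then show ?case by (intro exI[of _ "\<lambda>_. 0"]) auto
next
  case (insert y D)
  then obtain c where c: "\<forall>x. 0 \<le> c x" "\<forall>x. x \<notin> D \<longrightarrow> c x = 0"
      "\<forall>R x. R \<subseteq> S \<longrightarrow> x \<in> V \<longrightarrow> c x \<le> gain f x R \<or> x \<in> R"
      "sum c D = \<gamma> * (f (S \<union> D) - f S)"
    by auto
  define d where "d = c(y := \<gamma> * gain f y (S \<union> D))"
  have y: "y \<in> V - (S \<union> D)" and SD: "S \<union> D \<subseteq> V" using insert \<open>S \<subseteq> V\<close> by auto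
  have "0 \<le> \<gamma>" using bound by (simp add: submodularity_bound_def)
  then have "0 \<le> \<gamma> * gain f y (S \<union> D)" using gain_nonneg[OF mono SD] y by simp
  then have d0: "\<forall>x. 0 \<le> d x" using c(1) by (simp add: d_def)
  have "\<gamma> * gain f y (S \<union> D) \<le> gain f y R" if "R \<subseteq> S" for R
  proof -
    have "R \<union> (S \<union> D) = S \<union> D" using that by auto
    moreover have "R \<subseteq> V" using that \<open>S \<subseteq> V\<close> by auto
    ultimately show ?thesis
      using bound y SD unfolding submodularity_bound_def by metis
  qed
  then have d_le: "\<forall>R x. R \<subseteq> S \<longrightarrow> x \<in> V \<longrightarrow> d x \<le> gain f x R \<or> x \<in> R"
    using c(3) by (simp add: d_def)
  have "sum d (insert y D) = \<gamma> * gain f y (S \<union> D) + sum c D"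
    using insert(1,2) by (auto simp: d_def intro!: sum.cong)
  also have "\<dots> = \<gamma> * (f (S \<union> insert y D) - f S)"
    using c(4) by (simp add: gain_def algebra_simps)
  finally have "sum d (insert y D) = \<gamma> * (f (S \<union> insert y D) - f S)" .
  moreover have "\<forall>x. x \<notin> insert y D \<longrightarrow> d x = 0" using c(2) by (simp add: d_def)
  ultimately show ?case using d0 d_le by blast
qed

section \<open>The greedy run pays for every independent set\<close>

text \<open>Rejected elements stay dependent on the growing accepted set, so the examined set \<open>U\<close>
  never leaves the span of the accepted set \<open>S\<close>.\<close>

lemma greedy_invariant:
  assumes "matroid V F" and "(greedy_step V F K f)\<^sup>*\<^sup>* ({}, {}) (S, U)"
  shows "S \<subseteq> U \<and> U \<subseteq> V \<and> S \<in> F \<and> (\<forall>x \<in> U - S. S \<union> {x} \<notin> F)"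
  using assms(2)
proof (induction rule: rtranclp_induct2)
  case refl
  then show ?case using matroid.indep_empty[OF assms(1)] by simp
next
  case (step S U S' U')
  from step(2) show ?case
  proof cases
    case (reject i)
    then show ?thesis using step.IH by (auto simp: is_arg_max_def)
  next
    case (accept i)
    have "S \<union> {i} \<union> {x} \<notin> F" if "x \<in> U - S" for x
    proof
      assume "S \<union> {i} \<union> {x} \<in> F"
      then have "S \<union> {x} \<in> F" by (rule matroid.indep_subset[OF assms(1)]) auto
      then show False using step.IH that by blast
    qed
    then show ?thesis using accept step.IH by (auto simp: is_arg_max_def)
  qed
qed

text \<open>The acceptances so far pay for the examined elements of \<open>T\<close>, and each acceptance that is
  left over could still pay \<open>\<mu>\<close>, the charge of an unexamined element (or zero). Carrying the
  surplus in this aggregated form avoids constructing the matching. A rejected element of \<open>T\<close>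
  uses up one left-over acceptance, and there is one because the examined elements stay in the
  span of the accepted ones. The charges are built from the final greedy set \<open>S\<^sub>f\<close>, so the
  bound on them is only required over its subsets.\<close>

lemma greedy_pays_examined:
  fixes c :: "'a \<Rightarrow> real"
  assumes "matroid V F" and "T \<in> F"
    and c_nonneg: "\<And>x. 0 \<le> c x"
    and c_le: "\<And>R x. R \<subseteq> S\<^sub>f \<Longrightarrow> x \<in> V - R \<Longrightarrow> c x \<le> gain f x R"
    and "(greedy_step V F K f)\<^sup>*\<^sup>* ({}, {}) (S, U)" and "S \<subseteq> S\<^sub>f"
    and "\<mu> \<in> insert 0 (c ` (V - U))"
  shows "sum c (T \<inter> U) + (real (card S) - real (card (T \<inter> U))) * \<mu> \<le> f S - f {}"
  using assms(5-7)
proof (induction arbitrary: \<mu> rule: rtranclp_induct2)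
  case refl
  then show ?case by simp
next
  case (step S U S' U')
  interpret matroid V F by fact
  note inv = greedy_invariant[OF assms(1) step.hyps(1)]
  have fin: "finite U" "finite S"
    using inv finite_ground by (meson finite_subset subset_trans)+
  have finT: "finite (T \<inter> U)" using fin by simp
  have nonneg: "0 \<le> \<mu>" using step.prems c_nonneg by auto
  from step.hyps(2) show ?case
  proof cases
    case (reject i)
    have i: "i \<in> V - U" using reject by (simp add: is_arg_max_def)
    have IH: "sum c (T \<inter> U) + (real (card S) - real (card (T \<inter> U))) * \<nu> \<le> f S - f {}"
      if "\<nu> = \<mu> \<or> \<nu> = c i" for \<nu>
      using step.IH[of \<nu>] step.prems reject i that by auto
    show ?thesis
    proof (cases "i \<in> T")
      case True
      have TU: "T \<inter> (U \<union> {i}) = insert i (T \<inter> U)" using True by auto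
      have "\<forall>x \<in> U \<union> {i} - S. S \<union> {x} \<notin> F" using inv reject by auto
      moreover have "T \<inter> (U \<union> {i}) \<in> F" by (rule indep_subset[OF \<open>T \<in> F\<close>]) auto
      ultimately have "card (T \<inter> (U \<union> {i})) \<le> card S"
        using inv by (intro card_le_of_subset_span[of S "U \<union> {i}"]) auto
      then have free: "0 \<le> real (card S) - real (card (T \<inter> U)) - 1"
        using TU i finT by simp
      \<comment> \<open>One unit of surplus becomes worth \<open>c i\<close>, the others stay at \<open>\<mu>\<close>; the larger of the two
        values bounds all of them.\<close>
      define k where "k = real (card S) - real (card (T \<inter> U)) - 1"
      have "c i + k * \<mu> \<le> (k + 1) * max \<mu> (c i)"
        using free mult_left_mono[of \<mu> "max \<mu> (c i)" k] max.cobounded2[of "c i" \<mu>]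
        unfolding k_def[symmetric] distrib_right by linarith
      moreover have "sum c (T \<inter> U) + (k + 1) * max \<mu> (c i) \<le> f S - f {}"
        using IH[of "max \<mu> (c i)"] by (simp add: k_def max_def split: if_splits)
      ultimately have "sum c (T \<inter> U) + (c i + k * \<mu>) \<le> f S - f {}" by linarith
      moreover have "sum c (insert i (T \<inter> U)) = c i + sum c (T \<inter> U)"
        using i finT by simp
      moreover have "real (card S) - real (card (insert i (T \<inter> U))) = k"
        using i finT by (simp add: k_def)
      ultimately show ?thesis using reject TU by simp
    next
      case False
      then have "T \<inter> (U \<union> {i}) = T \<inter> U" by auto
      then show ?thesis using IH[of \<mu>] reject by simp
    qed
  next
    case (accept i)
    have i: "i \<in> V - U" using accept by (simp add: is_arg_max_def)
    have SSf: "S \<subseteq> S\<^sub>f" using step.prems accept by auto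
    have IH: "sum c (T \<inter> U) + (real (card S) - real (card (T \<inter> U))) * \<mu> \<le> f S - f {}"
      using step.IH[of \<mu>] step.prems accept by auto
    have f_eq: "f (S \<union> {i}) = f S + gain f i S" by (simp add: gain_def)
    have le_gain: "c x \<le> gain f i S" if "x \<in> V - U" for x
    proof -
      have "c x \<le> gain f x S" using c_le[OF SSf] that inv by blast
      also have "\<dots> \<le> gain f i S" using accept that by (force simp: is_arg_max_def not_less)
      finally show ?thesis .
    qed
    have "\<mu> \<le> gain f i S"
      using step.prems accept le_gain le_gain[OF i] c_nonneg[of i] by auto
    have "i \<notin> S" using i inv by blast
    then have cardS: "card (S \<union> {i}) = card S + 1" using fin by simp
    show ?thesis
    proof (cases "i \<in> T")
      case True
      have TU: "T \<inter> (U \<union> {i}) = insert i (T \<inter> U)" using True by auto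
      show ?thesis
        using accept IH le_gain[OF i] cardS i finT TU f_eq by (simp add: algebra_simps)
    next
      case False
      then have "T \<inter> (U \<union> {i}) = T \<inter> U" by auto
      then show ?thesis
        using accept IH \<open>\<mu> \<le> gain f i S\<close> cardS f_eq by (simp add: algebra_simps)
    qed
  qed
qed

text \<open>If the run stops with \<open>S\<close> of full rank, the elements of \<open>T\<close> that were never examined are
  paid for by the left-over acceptances, of which there are enough because \<open>T\<close> is not larger
  than \<open>S\<close>.\<close>

lemma greedy_pays:
  fixes c :: "'a \<Rightarrow> real"
  assumes "matroid V F" and "T \<in> F" and c_nonneg: "\<And>x. 0 \<le> c x"
    and c_le: "\<And>R x. R \<subseteq> S \<Longrightarrow> x \<in> V - R \<Longrightarrow> c x \<le> gain f x R"
    and "greedy_returns V F (matroid_rank F) f S"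
  shows "sum c T \<le> f S - f {}"
proof -
  interpret matroid V F by fact
  obtain U where run: "(greedy_step V F (matroid_rank F) f)\<^sup>*\<^sup>* ({}, {}) (S, U)"
    and stop: "U = V \<or> matroid_rank F \<le> card S"
    using assms(5) by (auto simp: greedy_returns_def)
  note inv = greedy_invariant[OF assms(1) run]
  have T: "T \<subseteq> V" using indep_subset_ground \<open>T \<in> F\<close> by blast
  then have finT: "finite T" using finite_ground finite_subset by blast
  have card_T: "card T \<le> card S"
    using stop
  proof
    assume "U = V"
    then show ?thesis using inv T \<open>T \<in> F\<close> by (intro card_le_of_subset_span[of S U]) auto
  next
    assume "matroid_rank F \<le> card S"
    then show ?thesis using card_le_matroid_rank[OF \<open>T \<in> F\<close>] by linarith
  qed
  define \<mu> where "\<mu> = Max (insert 0 (c ` (V - U)))"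
  have \<mu>: "\<mu> \<in> insert 0 (c ` (V - U))"
    unfolding \<mu>_def using finite_ground by (intro Max_in) auto
  have \<mu>_ge: "c x \<le> \<mu>" if "x \<in> V - U" for x
    unfolding \<mu>_def using finite_ground that by (intro Max_ge) auto
  have "0 \<le> \<mu>" unfolding \<mu>_def using finite_ground by (intro Max_ge) auto
  have split: "card T = card (T \<inter> U) + card (T - U)"
    using card_Int_Diff[OF finT] .
  have "sum c T = sum c (T \<inter> U) + sum c (T - U)"
    using sum.Int_Diff[OF finT] .
  also have "sum c (T - U) \<le> real (card (T - U)) * \<mu>"
    using T \<mu>_ge by (intro sum_bounded_above) auto
  also have "\<dots> \<le> (real (card S) - real (card (T \<inter> U))) * \<mu>"
    using split card_T \<open>0 \<le> \<mu>\<close> by (intro mult_right_mono) auto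
  also have "sum c (T \<inter> U) + (real (card S) - real (card (T \<inter> U))) * \<mu> \<le> f S - f {}"
    by (rule greedy_pays_examined[OF assms(1,2) c_nonneg c_le run order_refl \<mu>])
  finally show ?thesis by simp
qed

section \<open>The approximation guarantee\<close>

lemma greedy_guarantee:
  assumes "matroid V F" and mono: "strict_mono_on (Pow V) f"
    and bound: "submodularity_bound V f \<gamma>"
    and ret: "greedy_returns V F (matroid_rank F) f S" and "T \<in> F"
  shows "\<gamma> * (f T - f S) \<le> f S - f {}"
proof -
  interpret matroid V F by fact
  have S: "S \<subseteq> V"
    using ret greedy_invariant[OF assms(1)] unfolding greedy_returns_def by blast
  have T: "T \<subseteq> V" using indep_subset_ground \<open>T \<in> F\<close> by blast
  then have finT: "finite T" using finite_ground finite_subset by blast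
  obtain c where c: "\<forall>x. 0 \<le> c x" "\<forall>x. x \<notin> T - S \<longrightarrow> c x = 0"
      "\<forall>R x. R \<subseteq> S \<longrightarrow> x \<in> V \<longrightarrow> c x \<le> gain f x R \<or> x \<in> R"
      "sum c (T - S) = \<gamma> * (f (S \<union> (T - S)) - f S)"
    using charges_exist[OF bound mono S finite_Diff[OF finT] Diff_mono[OF T order_refl]] by blast
  have "f T \<le> f (S \<union> (T - S))"
    using S T by (intro strict_mono_on_leD[OF mono]) auto
  moreover have "0 \<le> \<gamma>" using bound by (simp add: submodularity_bound_def)
  ultimately have "\<gamma> * (f T - f S) \<le> sum c (T - S)"
    unfolding c(4) by (intro mult_left_mono) auto
  also have "\<dots> = sum c T"
    using c(2) finT by (intro sum.mono_neutral_left) auto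
  also have "\<dots> \<le> f S - f {}"
    by (rule greedy_pays[OF assms(1) \<open>T \<in> F\<close> _ _ ret]) (use c in auto)
  finally show ?thesis .
qed

theorem theorem1:
  fixes V :: "'a set" and F :: "'a set set" and f :: "'a set \<Rightarrow> real"
    and K :: nat and \<gamma> :: real and S_opt S_greedy :: "'a set"
  assumes "finite V"
    and "matroid V F"
    and "K = matroid_rank F" and "K \<ge> 1"
    and "strict_mono_on (Pow V) f"
    and "\<gamma> = submodularity_ratio V f"
    and "is_arg_max f (\<lambda>S. S \<in> F) S_opt"
    and "greedy_returns V F K f S_greedy"
  shows "(f S_greedy - f {}) / (f S_opt - f {}) \<ge> \<gamma> ^ 3 / (\<gamma> ^ 3 + 1)"
proof -
  interpret matroid V F by fact
  have "K \<in> card ` F"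
    unfolding \<open>K = matroid_rank F\<close> matroid_rank_def using indep_empty finite_indep by (intro Max_in) auto
  then obtain B where B: "B \<in> F" "B \<noteq> {}" using \<open>K \<ge> 1\<close> by force
  then have BV: "B \<subseteq> V" "V \<noteq> {}" using indep_subset_ground by auto
  have "f {} < f B"
    using B BV by (intro strict_mono_onD[OF assms(5)]) auto
  also have "f B \<le> f S_opt" using assms(7) B by (force simp: is_arg_max_def not_less)
  finally have pos: "0 < f S_opt - f {}" by simp
  have bound: "submodularity_bound V f \<gamma>" and le1: "\<gamma> \<le> 1"
    using submodularity_bound_ratio[OF BV(2) assms(5)]
      submodularity_ratio_le_1[OF BV(2) assms(5)] assms(6) by auto
  have \<gamma>0: "0 \<le> \<gamma>" using bound by (simp add: submodularity_bound_def)
  have "\<gamma> * (f S_opt - f S_greedy) \<le> f S_greedy - f {}"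
    using greedy_guarantee[OF assms(2,5) bound, of S_greedy S_opt] assms(3,7,8)
    by (simp add: is_arg_max_def)
  then have main: "\<gamma> * (f S_opt - f {}) \<le> (\<gamma> + 1) * (f S_greedy - f {})"
    by (simp add: algebra_simps)
  have "a / (a + 1) \<le> b / (b + 1)" if "0 \<le> a" "a \<le> b" for a b :: real
    using that by (simp add: field_simps)
  moreover have "\<gamma> ^ 3 \<le> \<gamma>" using power_decreasing[of 1 3 \<gamma>] \<gamma>0 le1 by simp
  ultimately have "\<gamma> ^ 3 / (\<gamma> ^ 3 + 1) \<le> \<gamma> / (\<gamma> + 1)"
    using \<gamma>0 by simp
  also have "\<dots> \<le> (f S_greedy - f {}) / (f S_opt - f {})"
    using main pos \<gamma>0 by (simp add: field_simps)
  finally show ?thesis .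
qed

end
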